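(* Let $n\ge 1$, let $\Sigma_1,\ldots,\Sigma_n,O$ be finite nonempty sets, and let $f\colon\Sigma_1\times\cdots\times\Sigma_n\to O$ be any function. Then $\mathrm{rk}(f)=\mathrm{dd}^{(1)}(f)$, i.e. the rank of $f$ equals the decoder depth of $f$ with one head.
   Context: **Rank.** An assignment is a pair $(i,\sigma)$ with $i\in[n]=\{1,\ldots,n\}$, $\sigma\in\Sigma_i$; $A$ is the (finite) set of all assignments. The assignment $(i,\sigma)$ is consistent with $\bar w=(\sigma_1,\ldots,\sigma_n)\in\Sigma_1\times\cdots\times\Sigma_n$ iff $\sigma_i=\sigma$. A permutation of $A$ is a bijection $\tau\colon\{1,\ldots,|A|\}\to A$. The a-query $q_\tau\colon\Sigma_1\times\cdots\times\Sigma_n\to A$ is defined by $q_\tau(\bar w)=\tau(k)$ for the minimal $k$ such that $\tau(k)$ is consistent with $\bar w$. A decision tree over a family $\mathcal F$ of queries (functions with domain $\Sigma_1\times\cdots\times\Sigma_n$) is a rooted tree in which each non-leaf node $v$ is labeled by some $q_v\in\mathcal F$ and has exactly $|\mathrm{Im}(q_v)|$ outgoing edges, labeled by the distinct elements of $\mathrm{Im}(q_v)$, and each leaf is labeled by an element of $O$. On input $\bar w$ one descends from the root, at each node $v$ following the edge labeled $q_v(\bar w)$, and outputs the label of the leaf reached. The tree computes $f$ if its output on every $\bar w$ is $f(\bar w)$. The depth is the maximal number of edges on a root-to-leaf path. $\mathrm{rk}(f)$ is the minimal depth of a decision tree over a-queries computing $f$. **Attention layer.** A (unique hard-attention) layer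 with $H$ heads and embedding dimension $d$ is a function $L\colon(\mathbb R^d)^*\to\mathbb R^d$ on nonempty finite sequences given by matrices $Q^{(h)},K^{(h)}\in\mathbb R^{d\times d}$ ($h=1,\ldots,H$), $W_1,W_2\in\mathbb R^{d\times d}$, $W_O\in\mathbb R^{d\times dH}$. On input $(x_1,\ldots,x_m)$, for each $h$ let $i_h$ be the leftmost index $i\in\{1,\ldots,m\}$ maximizing $\langle K^{(h)}x_i,Q^{(h)}x_m\rangle$, and let $\mathrm{head}_h=x_{i_h}$. Let $\mathrm{multihead}=W_O\cdot(\mathrm{head}_1;\ldots;\mathrm{head}_H)\in\mathbb R^d$ ($W_O$ applied to the vertical concatenation). Then $L(x_1,\ldots,x_m)=W_2\cdot\mathrm{ReLU}(W_1(\mathrm{multihead}+x_m))$, with $\mathrm{ReLU}(x)=\max\{0,x\}$ applied coordinatewise. **Decoder depth.** $f$ can be computed by $t$ iterations of a decoder with $H$ heads if there exist $d\in\mathbb N$, an attention layer $L$ with $H$ heads and embedding dimension $d$, a positional encoding $p\colon(\Sigma_1\times\{1\})\cup\cdots\cup(\Sigma_n\times\{n\})\cup\{\mathsf{EoL}\}\to\mathbb R^d$ ($\mathsf{EoL}$ a special symbol), and an arbitrary output function $\alpha\colon\mathbb R^d\to O$ such that for every $\bar w=(\sigma_1,\ldots,\sigma_n)$, setting $x_i=p(\sigma_i,i)$, $y_0=p(\mathsf{EoL})$ and $y_{s}=L(x_1,\ldots,x_n,y_0,y_1,\ldots,y_{s-1})$ for $s\ge1$, we have $f(\bar w)=\alpha(y_t)$.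 $\mathrm{dd}^{(H)}(f)$ is the minimal $t\ge0$ such that $f$ can be computed by $t$ iterations of a decoder with $H$ heads. *)

theory Defs
  imports "HOL-Library.FuncSet" "HOL-Library.Extended_Nat" "Jordan_Normal_Form.Matrix"
begin

text \<open>
  A node carries its query and a partial map from edge labels to subtrees, so the outgoing
  edges have distinct labels. The predicate \<open>dtree_over\<close> demands that these labels are
  exactly the elements of the image of the query on the input set \<open>X\<close>.
\<close>

datatype ('w, 'r, 'o) dtree =
    Leaf 'o
  | Node "'w \<Rightarrow> 'r" "'r \<Rightarrow> ('w, 'r, 'o) dtree option"

inductive dtree_over :: "'w set \<Rightarrow> ('w \<Rightarrow> 'r) set \<Rightarrow> 'o set \<Rightarrow> ('w, 'r, 'o) dtree \<Rightarrow> bool"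
  for X :: "'w set" and F :: "('w \<Rightarrow> 'r) set" and Out :: "'o set" where
  leaf: "out \<in> Out \<Longrightarrow> dtree_over X F Out (Leaf out)"
| node: "q \<in> F \<Longrightarrow> dom ch = q ` X \<Longrightarrow> (\<And>r T. ch r = Some T \<Longrightarrow> dtree_over X F Out T)
    \<Longrightarrow> dtree_over X F Out (Node q ch)"

primrec dtree_eval :: "('w, 'r, 'o) dtree \<Rightarrow> 'w \<Rightarrow> 'o" where
  "dtree_eval (Leaf out) = (\<lambda>w. out)"
| "dtree_eval (Node q ch) = (\<lambda>w. the (map_option dtree_eval (ch (q w))) w)"

primrec dtree_depth :: "('w, 'r, 'o) dtree \<Rightarrow> nat" where
  "dtree_depth (Leaf out) = 0"
| "dtree_depth (Node q ch) = Suc (Max (ran (\<lambda>r. map_option dtree_depth (ch r))))"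

text \<open>
  The product of the alphabets \<open>\<Sigma> 1, \<dots>, \<Sigma> n\<close> is the set of extensional functions on \<open>{1..n}\<close>.
\<close>

definition inputs :: "nat \<Rightarrow> (nat \<Rightarrow> 'a set) \<Rightarrow> (nat \<Rightarrow> 'a) set" where
  "inputs n \<Sigma> = (\<Pi>\<^sub>E i\<in>{1..n}. \<Sigma> i)"

definition assignments :: "nat \<Rightarrow> (nat \<Rightarrow> 'a set) \<Rightarrow> (nat \<times> 'a) set" where
  "assignments n \<Sigma> = (SIGMA i:{1..n}. \<Sigma> i)"

definition consistent :: "nat \<times> 'a \<Rightarrow> (nat \<Rightarrow> 'a) \<Rightarrow> bool" where
  "consistent a w \<longleftrightarrow> w (fst a) = snd a"

definition a_query ::
  "nat \<Rightarrow> (nat \<Rightarrow> 'a set) \<Rightarrow> (nat \<Rightarrow> nat \<times> 'a) \<Rightarrow> (nat \<Rightarrow> 'a) \<Rightarrow> nat \<times> 'a" where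
  "a_query n \<Sigma> \<tau> w =
     \<tau> (LEAST k. k \<in> {1..card (assignments n \<Sigma>)} \<and> consistent (\<tau> k) w)"

definition a_queries :: "nat \<Rightarrow> (nat \<Rightarrow> 'a set) \<Rightarrow> ((nat \<Rightarrow> 'a) \<Rightarrow> nat \<times> 'a) set" where
  "a_queries n \<Sigma> =
     {a_query n \<Sigma> \<tau> | \<tau>. bij_betw \<tau> {1..card (assignments n \<Sigma>)} (assignments n \<Sigma>)}"

text \<open>
  Minima are taken in \<^typ>\<open>enat\<close>: the infimum of a nonempty set is attained, and the infimum of
  the empty set is \<open>\<infinity>\<close> rather than an unspecified number.
\<close>

definition rk :: "nat \<Rightarrow> (nat \<Rightarrow> 'a set) \<Rightarrow> 'o set \<Rightarrow> ((nat \<Rightarrow> 'a) \<Rightarrow> 'o) \<Rightarrow> enat" where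
  "rk n \<Sigma> Out f =
     Inf {enat (dtree_depth T) | T. dtree_over (inputs n \<Sigma>) (a_queries n \<Sigma>) Out T
            \<and> (\<forall>w\<in>inputs n \<Sigma>. dtree_eval T w = f w)}"

text \<open>The field \<open>heads\<close> lists the pairs \<open>(Q, K)\<close> of query and key matrices, one per head.\<close>

record attention_layer =
  heads :: "(real mat \<times> real mat) list"
  W1 :: "real mat"
  W2 :: "real mat"
  WO :: "real mat"

definition is_layer :: "nat \<Rightarrow> nat \<Rightarrow> attention_layer \<Rightarrow> bool" where
  "is_layer d H L \<longleftrightarrow>
     length (heads L) = H
     \<and> (\<forall>(Q, K)\<in>set (heads L). Q \<in> carrier_mat d d \<and> K \<in> carrier_mat d d)
     \<and> W1 L \<in> carrier_mat d d \<and> W2 L \<in> carrier_mat d d \<and> WO L \<in> carrier_mat d (d * H)"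

text \<open>List positions, and hence attention positions, are counted from \<open>0\<close>.\<close>

definition attn_index :: "real mat \<Rightarrow> real mat \<Rightarrow> real vec list \<Rightarrow> nat" where
  "attn_index Q K xs =
     (let score = (\<lambda>i. (K *\<^sub>v (xs ! i)) \<bullet> (Q *\<^sub>v last xs))
      in LEAST i. i < length xs \<and> (\<forall>j<length xs. score j \<le> score i))"

definition multihead :: "attention_layer \<Rightarrow> real vec list \<Rightarrow> real vec" where
  "multihead L xs =
     WO L *\<^sub>v foldr (@\<^sub>v) (map (\<lambda>(Q, K). xs ! attn_index Q K xs) (heads L)) vNil"

definition relu :: "real vec \<Rightarrow> real vec" where
  "relu v = map_vec (max 0) v"

definition apply_layer :: "attention_layer \<Rightarrow> real vec list \<Rightarrow> real vec" where
  "apply_layer L xs = W2 L *\<^sub>v relu (W1 L *\<^sub>v (multihead L xs + last xs))"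

datatype 'a token = Sym 'a nat | EoL

definition tokens :: "nat \<Rightarrow> (nat \<Rightarrow> 'a set) \<Rightarrow> 'a token set" where
  "tokens n \<Sigma> = (\<Union>i\<in>{1..n}. (\<lambda>\<sigma>. Sym \<sigma> i) ` \<Sigma> i) \<union> {EoL}"

text \<open>
  \<open>decoder_seq L p n w s\<close> is the sequence \<open>x\<^sub>1, \<dots>, x\<^sub>n, y\<^sub>0, \<dots>, y\<^sub>s\<close>; its last entry is \<open>y\<^sub>s\<close>.
\<close>

primrec decoder_seq ::
  "attention_layer \<Rightarrow> ('a token \<Rightarrow> real vec) \<Rightarrow> nat \<Rightarrow> (nat \<Rightarrow> 'a) \<Rightarrow> nat \<Rightarrow> real vec list" where
  "decoder_seq L p n w 0 = map (\<lambda>i. p (Sym (w i) i)) [1..<Suc n] @ [p EoL]"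
| "decoder_seq L p n w (Suc s) =
     decoder_seq L p n w s @ [apply_layer L (decoder_seq L p n w s)]"

definition decoder_computes ::
  "nat \<Rightarrow> nat \<Rightarrow> (nat \<Rightarrow> 'a set) \<Rightarrow> 'o set \<Rightarrow> ((nat \<Rightarrow> 'a) \<Rightarrow> 'o) \<Rightarrow> nat \<Rightarrow> bool" where
  "decoder_computes H n \<Sigma> Out f t \<longleftrightarrow>
     (\<exists>d L p \<alpha>. is_layer d H L
        \<and> p \<in> tokens n \<Sigma> \<rightarrow> carrier_vec d
        \<and> \<alpha> \<in> carrier_vec d \<rightarrow> Out
        \<and> (\<forall>w\<in>inputs n \<Sigma>. f w = \<alpha> (last (decoder_seq L p n w t))))"

definition dd :: "nat \<Rightarrow> nat \<Rightarrow> (nat \<Rightarrow> 'a set) \<Rightarrow> 'o set \<Rightarrow> ((nat \<Rightarrow> 'a) \<Rightarrow> 'o) \<Rightarrow> enat" where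
  "dd H n \<Sigma> Out f = Inf {enat t | t. decoder_computes H n \<Sigma> Out f t}"

end

theory Submission
  imports Defs "HOL-Library.Product_Lexorder"
begin

text \<open>
  An a-query returns, among the assignments consistent with the input, the one of highest
  priority; a hard-attention head returns, among the tokens, the one of highest score. Sorting
  assignments by score and then by position turns attention over the input tokens into an
  a-query, and conversely. Both models are compared with a machine whose state determines a
  score on assignments, and whose next state is determined by the winning assignment.

  From decoder to tree: the state is the list \<open>y\<^sub>0, \<dots>, y\<^sub>s\<close>. It determines the best score
  among the \<open>y\<close>'s, so the winning input token suffices to find the attended vector.

  From tree to decoder: the state is the current subtree, with one-hot embeddings of assignments
  and subtrees. A token's score is positive on assignments and zero on states, so the head always
  attends to an input token; the ReLU then computes the conjunction of the one-hot codes of the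
  winning assignment and of the current subtree, from which the child is read off linearly.
\<close>

section \<open>Leftmost maximisers and hard attention\<close>

text \<open>The attended value itself instead of its index, so that mapping and appending need no
  index arithmetic. The non-strict comparison lets the earlier entry win ties.\<close>

primrec leftmost_max :: "('b \<Rightarrow> real) \<Rightarrow> 'b list \<Rightarrow> 'b" where
  "leftmost_max s [] = undefined"
| "leftmost_max s (x # xs) =
     (if xs = [] \<or> s (leftmost_max s xs) \<le> s x then x else leftmost_max s xs)"

text \<open>Separates the input tokens from the vectors \<open>y\<close> that follow them; on a tie
  the input token wins.\<close>

lemma leftmost_max_append:
  assumes "xs \<noteq> []" "ys \<noteq> []"
  shows "leftmost_max s (xs @ ys) =
    (if s (leftmost_max s ys) \<le> s (leftmost_max s xs) then leftmost_max s xs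
     else leftmost_max s ys)"
  using assms(1)
proof (induction xs)
  case (Cons x xs)
  then show ?case using assms(2) by (cases "xs = []") auto
qed simp

lemma leftmost_max_map:
  "xs \<noteq> [] \<Longrightarrow> leftmost_max s (map g xs) = g (leftmost_max (\<lambda>x. s (g x)) xs)"
  by (induction xs) auto

lemma leftmost_max_in_set: "xs \<noteq> [] \<Longrightarrow> leftmost_max s xs \<in> set xs"
  by (induction xs) auto

lemma leftmost_max_cong:
  assumes "xs \<noteq> []" "\<And>x. x \<in> set xs \<Longrightarrow> s x = s' x"
  shows "leftmost_max s xs = leftmost_max s' xs"
  using assms
proof (induction xs)
  case (Cons x xs)
  then show ?case
    using leftmost_max_in_set[of xs s'] by (cases "xs = []") auto
qed simp

lemma leftmost_max_ge: "x \<in> set xs \<Longrightarrow> s x \<le> s (leftmost_max s xs)"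
  by (induction xs) auto

text \<open>The strict inequality to the left is what identifies \<open>i\<close> with the
  \<open>LEAST\<close> index in \<open>attn_index\<close>.\<close>

lemma leftmost_max_index:
  assumes "xs \<noteq> []"
  obtains i where "i < length xs" "leftmost_max s xs = xs ! i"
    "\<And>j. j < length xs \<Longrightarrow> s (xs ! j) \<le> s (xs ! i)" "\<And>j. j < i \<Longrightarrow> s (xs ! j) < s (xs ! i)"
proof -
  have "\<exists>i<length xs. leftmost_max s xs = xs ! i \<and> (\<forall>j<i. s (xs ! j) < s (xs ! i))"
    using assms
  proof (induction xs)
    case (Cons x xs)
    show ?case
    proof (cases "xs = [] \<or> s (leftmost_max s xs) \<le> s x")
      case True
      then show ?thesis by (intro exI[of _ 0]) auto
    next
      case False
      then obtain i where i: "i < length xs" "leftmost_max s xs = xs ! i"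
          "\<forall>j<i. s (xs ! j) < s (xs ! i)"
        using Cons.IH by auto
      have "s ((x # xs) ! j) < s ((x # xs) ! Suc i)" if "j < Suc i" for j
        using that i False by (cases j) auto
      then show ?thesis using i False by (intro exI[of _ "Suc i"]) auto
    qed
  qed simp
  then show ?thesis
    using that leftmost_max_ge[of _ xs s] by (metis nth_mem)
qed

lemma nth_attn_index:
  assumes "xs \<noteq> []"
  shows "xs ! attn_index Q K xs = leftmost_max (\<lambda>x. (K *\<^sub>v x) \<bullet> (Q *\<^sub>v last xs)) xs"
proof -
  obtain i where i: "i < length xs"
      "leftmost_max (\<lambda>x. (K *\<^sub>v x) \<bullet> (Q *\<^sub>v last xs)) xs = xs ! i"
      "\<And>j. j < length xs \<Longrightarrow> (K *\<^sub>v (xs ! j)) \<bullet> (Q *\<^sub>v last xs) \<le> (K *\<^sub>v (xs ! i)) \<bullet> (Q *\<^sub>v last xs)"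
      "\<And>j. j < i \<Longrightarrow> (K *\<^sub>v (xs ! j)) \<bullet> (Q *\<^sub>v last xs) < (K *\<^sub>v (xs ! i)) \<bullet> (Q *\<^sub>v last xs)"
    by (rule leftmost_max_index[OF assms, where s = "\<lambda>x. (K *\<^sub>v x) \<bullet> (Q *\<^sub>v last xs)"])
      (rule that; assumption)
  have "attn_index Q K xs = i"
    unfolding attn_index_def Let_def
    by (rule Least_equality) (use i in \<open>auto simp: not_le[symmetric]\<close>)
  then show ?thesis using i by simp
qed

lemma apply_layer_one_head:
  assumes "heads L = [(Q, K)]" "xs \<noteq> []"
  shows "apply_layer L xs = W2 L *\<^sub>v relu (W1 L *\<^sub>v
    (WO L *\<^sub>v leftmost_max (\<lambda>x. (K *\<^sub>v x) \<bullet> (Q *\<^sub>v last xs)) xs + last xs))"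
proof -
  have "v @\<^sub>v vNil = v" for v :: "real vec"
    by (rule eq_vecI) auto
  then show ?thesis
    using assms by (simp add: apply_layer_def multihead_def nth_attn_index)
qed

section \<open>Machines driven by the consistent assignments\<close>

text \<open>A list in order of position, so that its leftmost maximum breaks ties as attention over
  the input tokens does.\<close>

definition consistent_assignments :: "nat \<Rightarrow> (nat \<Rightarrow> 'a) \<Rightarrow> (nat \<times> 'a) list" where
  "consistent_assignments n w = map (\<lambda>i. (i, w i)) [1..<Suc n]"

text \<open>The input enters a step only through the winning assignment; hence one a-query can
  simulate a step.\<close>

definition machine_step ::
  "nat \<Rightarrow> ('s \<Rightarrow> nat \<times> 'a \<Rightarrow> real) \<Rightarrow> ('s \<Rightarrow> nat \<times> 'a \<Rightarrow> 's) \<Rightarrow> (nat \<Rightarrow> 'a) \<Rightarrow> 's \<Rightarrow> 's" where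
  "machine_step n r \<delta> w s = \<delta> s (leftmost_max (r s) (consistent_assignments n w))"

lemma consistent_assignments_nonempty: "n \<ge> 1 \<Longrightarrow> consistent_assignments n w \<noteq> []"
  by (simp add: consistent_assignments_def)

lemma set_consistent_assignments:
  assumes "w \<in> inputs n \<Sigma>"
  shows "set (consistent_assignments n w) = {a \<in> assignments n \<Sigma>. consistent a w}"
  using assms by (auto simp: consistent_assignments_def assignments_def consistent_def inputs_def PiE_mem)

lemma finite_assignments:
  assumes "\<And>i. i \<in> {1..n} \<Longrightarrow> finite (\<Sigma> i)"
  shows "finite (assignments n \<Sigma>)"
  using assms by (auto simp: assignments_def)

section \<open>A-queries as scores on assignments\<close>

text \<open>The minimum in \<open>a_query\<close> is attained: as n >= 1, the input has a consistent
  assignment, and \<open>\<tau>\<close> reaches every assignment.\<close>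

lemma a_query_first_consistent:
  assumes "n \<ge> 1" "w \<in> inputs n \<Sigma>"
    and \<tau>: "bij_betw \<tau> {1..card (assignments n \<Sigma>)} (assignments n \<Sigma>)"
  obtains k where "k \<in> {1..card (assignments n \<Sigma>)}" "a_query n \<Sigma> \<tau> w = \<tau> k"
    "\<tau> k \<in> set (consistent_assignments n w)"
    "\<And>l. l \<in> {1..card (assignments n \<Sigma>)} \<Longrightarrow> \<tau> l \<in> set (consistent_assignments n w) \<Longrightarrow> k \<le> l"
proof -
  let ?N = "{1..card (assignments n \<Sigma>)}"
  let ?P = "\<lambda>k. k \<in> ?N \<and> consistent (\<tau> k) w"
  have eq: "?P l \<longleftrightarrow> l \<in> ?N \<and> \<tau> l \<in> set (consistent_assignments n w)" for l
    using set_consistent_assignments[OF assms(2)] bij_betwE[OF \<tau>] by auto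
  obtain a where "a \<in> set (consistent_assignments n w)"
    using consistent_assignments_nonempty[OF assms(1), of w] by (meson last_in_set)
  moreover have "\<tau> ` ?N = assignments n \<Sigma>"
    using \<tau> by (simp add: bij_betw_def)
  ultimately obtain k0 where "?P k0"
    unfolding set_consistent_assignments[OF assms(2)] by (smt (verit) imageE mem_Collect_eq)
  then have "?P (LEAST k. ?P k)" by (rule LeastI)
  moreover have "(LEAST k. ?P k) \<le> l" if "?P l" for l
    using that by (rule Least_le)
  ultimately show ?thesis
    using that[of "LEAST k. ?P k"] eq by (auto simp: a_query_def)
qed

text \<open>Assignments with equal keys share their position, and at most one of them is consistent
  with a given input, so their relative order in the permutation does not affect the answer.\<close>

lemma a_query_of_score:
  fixes r :: "nat \<times> 'a \<Rightarrow> real"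
  assumes "n \<ge> 1" and fin: "finite (assignments n \<Sigma>)"
  obtains q where "q \<in> a_queries n \<Sigma>"
    "\<And>w. w \<in> inputs n \<Sigma> \<Longrightarrow> q w = leftmost_max r (consistent_assignments n w)"
proof -
  let ?A = "assignments n \<Sigma>"
  obtain as where as: "set as = ?A" "distinct as"
    using finite_distinct_list[OF fin] by blast
  \<comment> \<open>The position breaks ties, as equal scores are resolved to the left.\<close>
  define key where "key a = (- r a, fst a)" for a
  define bs where "bs = sort_key key as"
  have bs: "set bs = ?A" "distinct bs" "sorted (map key bs)"
    using as by (auto simp: bs_def)
  have len: "length bs = card ?A"
    using bs distinct_card by metis
  \<comment> \<open>Permutations count from 1, lists from 0.\<close>
  define \<tau> where "\<tau> k = bs ! (k - 1)" for k
  have "bij_betw (\<lambda>k. k - 1) {1..card ?A} {..<length bs}"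
    by (rule bij_betw_byWitness[where f' = Suc]) (auto simp: len)
  moreover have "bij_betw ((!) bs) {..<length bs} ?A"
    using bs by (intro bij_betw_nth) auto
  ultimately have \<tau>: "bij_betw \<tau> {1..card ?A} ?A"
    using bij_betw_trans by (fastforce simp: \<tau>_def[abs_def] comp_def)
  have "a_query n \<Sigma> \<tau> w = leftmost_max r (consistent_assignments n w)" if w: "w \<in> inputs n \<Sigma>" for w
  proof -
    obtain k where k: "k \<in> {1..card ?A}" "a_query n \<Sigma> \<tau> w = \<tau> k" "\<tau> k \<in> set (consistent_assignments n w)"
        "\<And>l. l \<in> {1..card ?A} \<Longrightarrow> \<tau> l \<in> set (consistent_assignments n w) \<Longrightarrow> k \<le> l"
      using a_query_first_consistent[OF assms(1) w \<tau>] by metis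
    have first: "key (\<tau> k) \<le> key a" if "a \<in> set (consistent_assignments n w)" for a
    proof -
      have "a \<in> ?A" using that set_consistent_assignments[OF w] by auto
      then obtain l where l: "l \<in> {1..card ?A}" "a = \<tau> l"
        using \<tau> by (metis bij_betw_def imageE)
      then have "k \<le> l" using k that by auto
      then have "k - 1 \<le> l - 1" "l - 1 < length bs" using l len by auto
      then show ?thesis
        using sorted_nth_mono[OF bs(3), of "k - 1" "l - 1"] l by (simp add: \<tau>_def)
    qed
    let ?xs = "consistent_assignments n w"
    obtain i where i: "i < length ?xs"
        "leftmost_max r ?xs = ?xs ! i"
        "\<And>j. j < length ?xs \<Longrightarrow> r (?xs ! j) \<le> r (?xs ! i)"
        "\<And>j. j < i \<Longrightarrow> r (?xs ! j) < r (?xs ! i)"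
      using leftmost_max_index[where s = r, OF consistent_assignments_nonempty[OF assms(1), of w]] by metis
    obtain j where j: "j < length ?xs" "\<tau> k = ?xs ! j"
      using k(3) by (metis in_set_conv_nth)
    \<comment> \<open>Index \<open>j\<close> is picked by the query, \<open>i\<close> by the
      leftmost maximum. The key order excludes a smaller score at \<open>j\<close> and a tie with i
      < j; maximality of \<open>i\<close> and strictness to its left exclude the other
      cases.\<close>
    have "key (?xs ! j) \<le> key (?xs ! i)"
      using first[of "?xs ! i"] i j by simp
    moreover have "fst (?xs ! l) = Suc l" if "l < length ?xs" for l
      using that by (simp add: consistent_assignments_def del: upt_Suc)
    ultimately have "r (?xs ! i) \<le> r (?xs ! j) \<and> j \<le> i
        \<or> r (?xs ! i) < r (?xs ! j)"
      using i(1) j(1) by (auto simp: key_def less_eq_prod_def)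
    then have "j = i"
      using i(3)[OF j(1)] i(4)[of j] by linarith
    then show ?thesis using i j k by simp
  qed
  then show ?thesis
    using that[of "a_query n \<Sigma> \<tau>"] \<tau> by (auto simp: a_queries_def)
qed

text \<open>Any score decreasing along the permutation works. Positivity is arranged for the
  decoder, where the codes of states score zero.\<close>

lemma score_of_a_query:
  assumes "n \<ge> 1" and "q \<in> a_queries n \<Sigma>"
  obtains r :: "nat \<times> 'a \<Rightarrow> real" where "\<And>a. a \<in> assignments n \<Sigma> \<Longrightarrow> r a > 0"
    "\<And>w. w \<in> inputs n \<Sigma> \<Longrightarrow> leftmost_max r (consistent_assignments n w) = q w"
proof -
  let ?A = "assignments n \<Sigma>"
  obtain \<tau> where q: "q = a_query n \<Sigma> \<tau>" and \<tau>: "bij_betw \<tau> {1..card ?A} ?A"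
    using assms(2) by (auto simp: a_queries_def)
  define pos where "pos = inv_into {1..card ?A} \<tau>"
  have pos: "pos a \<in> {1..card ?A}" "\<tau> (pos a) = a" if "a \<in> ?A" for a
    using that \<tau> f_inv_into_f[of a \<tau>] inv_into_into[of a \<tau>]
    unfolding pos_def bij_betw_def by metis+
  have pos_\<tau>: "pos (\<tau> k) = k" if "k \<in> {1..card ?A}" for k
    using that \<tau> by (simp add: pos_def bij_betw_def)
  \<comment> \<open>At least 1, since positions run from 1 to \<open>card ?A\<close>.\<close>
  define r where "r a = real (card ?A) + 1 - real (pos a)" for a
  have "leftmost_max r (consistent_assignments n w) = q w" if w: "w \<in> inputs n \<Sigma>" for w
  proof -
    obtain k where k: "k \<in> {1..card ?A}" "a_query n \<Sigma> \<tau> w = \<tau> k" "\<tau> k \<in> set (consistent_assignments n w)"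
        "\<And>l. l \<in> {1..card ?A} \<Longrightarrow> \<tau> l \<in> set (consistent_assignments n w) \<Longrightarrow> k \<le> l"
      using a_query_first_consistent[OF assms(1) w \<tau>] by metis
    define a where "a = leftmost_max r (consistent_assignments n w)"
    have a: "a \<in> set (consistent_assignments n w)" "a \<in> ?A"
      using leftmost_max_in_set[OF consistent_assignments_nonempty[OF assms(1)]] set_consistent_assignments[OF w]
      unfolding a_def by blast+
    have "r (\<tau> k) \<le> r a"
      unfolding a_def using k(3) by (rule leftmost_max_ge)
    then have "pos a \<le> k"
      using k(1) by (simp add: r_def pos_\<tau>)
    moreover have "k \<le> pos a"
      using k(4) pos[OF a(2)] a(1) by simp
    ultimately show ?thesis
      using pos[OF a(2)] k(2) q a_def by simp
  qed
  moreover have "r a > 0" if "a \<in> ?A" for a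
    using pos(1)[OF that] by (simp add: r_def)
  ultimately show ?thesis using that by blast
qed

section \<open>Machines and decision trees\<close>

text \<open>Unfold \<open>t\<close> steps: the answers along a path determine the state, hence the
  score and the query to place next. Every leaf lies at depth exactly \<open>t\<close>.\<close>

lemma dtree_of_machine:
  assumes "n \<ge> 1" "finite (assignments n \<Sigma>)" "inputs n \<Sigma> \<noteq> {}"
    and "\<And>s. g s \<in> Out"
  shows "\<exists>T. dtree_over (inputs n \<Sigma>) (a_queries n \<Sigma>) Out T \<and> dtree_depth T = t
    \<and> (\<forall>w\<in>inputs n \<Sigma>. dtree_eval T w = g ((machine_step n r \<delta> w ^^ t) s))"
proof (induction t arbitrary: s)
  case 0
  show ?case
    by (rule exI[of _ "Leaf (g s)"]) (use assms(4) in \<open>auto intro: dtree_over.leaf\<close>)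
next
  case (Suc t)
  obtain q where q: "q \<in> a_queries n \<Sigma>"
      "\<And>w. w \<in> inputs n \<Sigma> \<Longrightarrow> q w = leftmost_max (r s) (consistent_assignments n w)"
    using a_query_of_score[OF assms(1,2)] by metis
  have "\<forall>a. \<exists>T. dtree_over (inputs n \<Sigma>) (a_queries n \<Sigma>) Out T \<and> dtree_depth T = t
      \<and> (\<forall>w\<in>inputs n \<Sigma>. dtree_eval T w = g ((machine_step n r \<delta> w ^^ t) (\<delta> s a)))"
    using Suc.IH by simp
  then obtain C where C: "\<And>a. dtree_over (inputs n \<Sigma>) (a_queries n \<Sigma>) Out (C a)"
      "\<And>a. dtree_depth (C a) = t"
      "\<And>a w. w \<in> inputs n \<Sigma> \<Longrightarrow> dtree_eval (C a) w = g ((machine_step n r \<delta> w ^^ t) (\<delta> s a))"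
    unfolding choice_iff by blast
  \<comment> \<open>Restricted to the answers that occur, as \<open>dtree_over\<close> wants the
    edge labels to be exactly the image of the query.\<close>
  define ch where "ch a = (if a \<in> q ` inputs n \<Sigma> then Some (C a) else None)" for a
  have "dtree_over (inputs n \<Sigma>) (a_queries n \<Sigma>) Out (Node q ch)"
    using q C by (intro dtree_over.node) (auto simp: ch_def dom_def split: if_splits)
  moreover have "ran ch = C ` q ` inputs n \<Sigma>"
    by (auto simp: ran_def ch_def)
  \<comment> \<open>An input exists, so the node has a child and \<open>Max\<close> is not taken
    over the empty set.\<close>
  then have "ran (\<lambda>a. map_option dtree_depth (ch a)) = {t}"
    using assms(3) C(2) by (simp add: ran_map_option image_image image_constant_conv)
  then have "dtree_depth (Node q ch) = Suc t" by simp
  moreover have "dtree_eval (Node q ch) w = g ((machine_step n r \<delta> w ^^ Suc t) s)"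
    if "w \<in> inputs n \<Sigma>" for w
    using that q C by (simp add: ch_def funpow_swap1 machine_step_def)
  ultimately show ?case by blast
qed

text \<open>Supplies a finite state space for the machine read off a tree; finiteness is what later
  gives a finite embedding dimension. It passes up the tree because a query has finitely many values
  on the finite set \<open>X\<close>.\<close>

lemma dtree_subtrees:
  assumes "dtree_over X F Out T" "finite X"
  shows "\<exists>S. finite S \<and> T \<in> S \<and> (\<forall>T'\<in>S. dtree_over X F Out T') \<and>
    (\<forall>q ch r T'. Node q ch \<in> S \<longrightarrow> ch r = Some T' \<longrightarrow> T' \<in> S)"
  using assms(1)
proof induction
  case (leaf out)
  then show ?case by (intro exI[of _ "{Leaf out}"]) (auto intro: dtree_over.leaf)
next
  case (node q ch)
  have "\<exists>S. finite S \<and> T \<in> S \<and> (\<forall>T'\<in>S. dtree_over X F Out T') \<and>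
      (\<forall>q ch r T'. Node q ch \<in> S \<longrightarrow> ch r = Some T' \<longrightarrow> T' \<in> S)" if "T \<in> ran ch" for T
    using that node.IH by (auto simp: ran_def)
  then obtain S where S: "\<And>T. T \<in> ran ch \<Longrightarrow> finite (S T) \<and> T \<in> S T
      \<and> (\<forall>T'\<in>S T. dtree_over X F Out T')
      \<and> (\<forall>q ch r T'. Node q ch \<in> S T \<longrightarrow> ch r = Some T' \<longrightarrow> T' \<in> S T)"
    by metis
  have "finite (ran ch)"
    using node(2) assms(2) by (simp add: finite_ran)
  moreover have "dtree_over X F Out (Node q ch)"
    using node by (auto intro: dtree_over.node)
  moreover have "T' \<in> insert (Node q ch) (\<Union>T\<in>ran ch. S T)"
    if N: "Node q' ch' \<in> insert (Node q ch) (\<Union>T\<in>ran ch. S T)" and T': "ch' r = Some T'" for q' ch' r T'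
  proof (cases "ch' = ch")
    case True
    then have "T' \<in> ran ch" using T' by (auto simp: ran_def)
    then show ?thesis using S[of T'] by blast
  next
    case False
    then obtain T where T: "T \<in> ran ch" "Node q' ch' \<in> S T" using N by auto
    then have "T' \<in> S T" using S[OF T(1)] T' by blast
    then show ?thesis using T(1) by blast
  qed
  ultimately show ?case
    using S by (intro exI[of _ "insert (Node q ch) (\<Union>T\<in>ran ch. S T)"]) auto
qed

lemma dtree_depth_child:
  assumes "finite (dom ch)" "ch r = Some T"
  shows "dtree_depth T < dtree_depth (Node q ch)"
proof -
  have "finite (ran (\<lambda>r. map_option dtree_depth (ch r)))"
    by (rule finite_ran) (use assms(1) in \<open>simp add: dom_def\<close>)
  moreover have "dtree_depth T \<in> ran (\<lambda>r. map_option dtree_depth (ch r))"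
    using assms(2) by (auto simp: ran_def)
  ultimately show ?thesis by (simp add: le_imp_less_Suc)
qed

text \<open>A node ranks assignments by the score of its query, so the winner is the answer and
  selects the child. Leaves are fixed points, so short branches wait until
  \<open>dtree_depth T\<close> steps have passed.\<close>

lemma machine_of_dtree:
  fixes T :: "(nat \<Rightarrow> 'a, nat \<times> 'a, 'o) dtree"
  assumes "n \<ge> 1" "finite (inputs n \<Sigma>)"
    and T: "dtree_over (inputs n \<Sigma>) (a_queries n \<Sigma>) Out T"
  obtains S r \<delta> where "finite S" "T \<in> S"
    "\<And>T' a. T' \<in> S \<Longrightarrow> \<delta> T' a \<in> S"
    "\<And>T' a. T' \<in> S \<Longrightarrow> a \<in> assignments n \<Sigma> \<Longrightarrow> r T' a > 0"
    "\<And>w. w \<in> inputs n \<Sigma> \<Longrightarrow> (machine_step n r \<delta> w ^^ dtree_depth T) T = Leaf (dtree_eval T w)"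
    "\<And>out. Leaf out \<in> S \<Longrightarrow> out \<in> Out"
proof -
  obtain S where S: "finite S" "T \<in> S"
      "\<And>T'. T' \<in> S \<Longrightarrow> dtree_over (inputs n \<Sigma>) (a_queries n \<Sigma>) Out T'"
      "\<And>q ch r T'. Node q ch \<in> S \<Longrightarrow> ch r = Some T' \<Longrightarrow> T' \<in> S"
    using dtree_subtrees[OF T assms(2)] by blast
  have "\<forall>q. \<exists>r :: nat \<times> 'a \<Rightarrow> real. q \<in> a_queries n \<Sigma> \<longrightarrow> (\<forall>a\<in>assignments n \<Sigma>. r a > 0)
      \<and> (\<forall>w\<in>inputs n \<Sigma>. leftmost_max r (consistent_assignments n w) = q w)"
    using score_of_a_query[OF assms(1), of _ \<Sigma>] by metis
  then obtain score :: "((nat \<Rightarrow> 'a) \<Rightarrow> nat \<times> 'a) \<Rightarrow> nat \<times> 'a \<Rightarrow> real" where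
    score: "\<And>q a. q \<in> a_queries n \<Sigma> \<Longrightarrow> a \<in> assignments n \<Sigma> \<Longrightarrow> score q a > 0"
      "\<And>q w. q \<in> a_queries n \<Sigma> \<Longrightarrow> w \<in> inputs n \<Sigma> \<Longrightarrow>
        leftmost_max (score q) (consistent_assignments n w) = q w"
    unfolding choice_iff by blast
  \<comment> \<open>The constant 1 at leaves serves only positivity.\<close>
  define r where "r T' = (case T' of Leaf out \<Rightarrow> \<lambda>a. 1 | Node q ch \<Rightarrow> score q)"
    for T' :: "(nat \<Rightarrow> 'a, nat \<times> 'a, 'o) dtree"
  \<comment> \<open>Staying put on \<open>None\<close> keeps the state inside \<open>S\<close> for
    assignments that label no edge.\<close>
  define \<delta> where "\<delta> T' a = (case T' of Leaf out \<Rightarrow> T'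
      | Node q ch \<Rightarrow> (case ch a of Some T'' \<Rightarrow> T'' | None \<Rightarrow> T'))"
    for T' :: "(nat \<Rightarrow> 'a, nat \<times> 'a, 'o) dtree" and a
  have run_leaf: "(machine_step n r \<delta> w ^^ k) (Leaf out) = Leaf out" for w k out
    by (induction k) (auto simp: machine_step_def \<delta>_def)
  \<comment> \<open>Stated for every \<open>k\<close> from the depth upwards, since a child may be
    shallower than its siblings.\<close>
  have run: "(machine_step n r \<delta> w ^^ k) T = Leaf (dtree_eval T w)"
    if w: "w \<in> inputs n \<Sigma>" and "dtree_depth T \<le> k" for w k
    using T that(2)
  proof (induction arbitrary: k)
    case (leaf out)
    then show ?case by (simp add: run_leaf)
  next
    case (node q ch)
    have "q w \<in> dom ch" using node(2) w by simp
    then obtain T' where T': "ch (q w) = Some T'" by blast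
    have "finite (dom ch)" using node(2) assms(2) by simp
    from dtree_depth_child[OF this T', of q] node.prems
    obtain l where l: "k = Suc l" "dtree_depth T' \<le> l"
      by (cases k) auto
    have "machine_step n r \<delta> w (Node q ch) = T'"
      using score(2)[OF node(1) w] T' by (simp add: machine_step_def r_def \<delta>_def)
    then show ?case
      using node.IH[OF T' l(2)] T' l(1) by (simp add: funpow_swap1)
  qed
  show ?thesis
  proof (rule that[of S \<delta> r])
    show "\<delta> T' a \<in> S" if "T' \<in> S" for T' a
      using that by (auto simp: \<delta>_def intro: S(4) split: dtree.split option.split)
    show "r T' a > 0" if "T' \<in> S" "a \<in> assignments n \<Sigma>" for T' a
    proof (cases T')
      case (Node q ch)
      then have "q \<in> a_queries n \<Sigma>"
        using S(3)[OF that(1)] by (auto elim: dtree_over.cases)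
      then show ?thesis using score(1) that(2) Node by (simp add: r_def)
    qed (simp add: r_def)
    show "out \<in> Out" if "Leaf out \<in> S" for out
      using S(3)[OF that] by (auto elim: dtree_over.cases)
  qed (use S run in auto)
qed

section \<open>Machines and decoders\<close>

lemma machine_of_decoder:
  assumes "n \<ge> 1" "heads L = [(Q, K)]"
  shows "\<exists>(r :: real vec list \<Rightarrow> nat \<times> 'a \<Rightarrow> real) \<delta>. \<forall>w t.
    last (decoder_seq L p n w t) = last ((machine_step n r \<delta> w ^^ t) [p EoL])"
proof -
  define sc where "sc ys x = (K *\<^sub>v x) \<bullet> (Q *\<^sub>v last ys)" for ys x
  define emb where "emb a = p (Sym (snd a) (fst a))" for a
  define r where "r ys a = sc ys (emb a)" for ys a
  \<comment> \<open>The best \<open>y\<close> is computed from the state alone and then compared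
    with the winning input token, which stands further left and so wins ties.\<close>
  define \<delta> where "\<delta> ys a = ys @ [W2 L *\<^sub>v relu (W1 L *\<^sub>v
      (WO L *\<^sub>v (if sc ys (leftmost_max (sc ys) ys) \<le> sc ys (emb a) then emb a
         else leftmost_max (sc ys) ys) + last ys))]" for ys a
  have "decoder_seq L p n w t = map emb (consistent_assignments n w) @ (machine_step n r \<delta> w ^^ t) [p EoL]
      \<and> (machine_step n r \<delta> w ^^ t) [p EoL] \<noteq> []" for w t
  proof (induction t)
    case 0
    show ?case by (simp add: consistent_assignments_def emb_def comp_def del: upt_Suc)
  next
    case (Suc t)
    define ys where "ys = (machine_step n r \<delta> w ^^ t) [p EoL]"
    have ys: "ys \<noteq> []" "decoder_seq L p n w t = map emb (consistent_assignments n w) @ ys"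
      using Suc.IH by (auto simp: ys_def)
    have "apply_layer L (map emb (consistent_assignments n w) @ ys) = W2 L *\<^sub>v relu (W1 L *\<^sub>v
        (WO L *\<^sub>v leftmost_max (sc ys) (map emb (consistent_assignments n w) @ ys) + last ys))"
      using ys(1) by (subst apply_layer_one_head[OF assms(2)]) (auto simp: sc_def[abs_def])
    moreover have "leftmost_max (sc ys) (map emb (consistent_assignments n w) @ ys) =
        (let x = emb (leftmost_max (r ys) (consistent_assignments n w)) in
         if sc ys (leftmost_max (sc ys) ys) \<le> sc ys x then x else leftmost_max (sc ys) ys)"
      using ys(1) consistent_assignments_nonempty[OF assms(1), of w]
      by (simp add: leftmost_max_append leftmost_max_map r_def[abs_def])
    ultimately have "machine_step n r \<delta> w ys = ys @ [apply_layer L (map emb (consistent_assignments n w) @ ys)]"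
      using ys(1) consistent_assignments_nonempty[OF assms(1), of w]
      by (simp add: machine_step_def \<delta>_def Let_def)
    then show ?case
      using ys(2) by (simp add: ys_def[symmetric])
  qed
  then show ?thesis by (intro exI[of _ r] exI[of _ \<delta>]) auto
qed

lemma mult_mat_unit_vec:
  assumes "j < nc"
  shows "mat nr nc F *\<^sub>v unit_vec nc j = vec nr (\<lambda>i. (F (i, j) :: real))"
  using assms by (intro eq_vecI) auto

text \<open>The query matrix turns the code of the current state into a vector of scores. Key and
  output matrices are identities, so the head is the code of the winner, and the residual term adds
  the code of the current state.\<close>

lemma decoder_of_machine:
  fixes S :: "'s set" and r :: "'s \<Rightarrow> nat \<times> 'a \<Rightarrow> real"
  assumes "n \<ge> 1" "finite (assignments n \<Sigma>)" "finite S" "s0 \<in> S"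
    and \<delta>: "\<And>s a. s \<in> S \<Longrightarrow> a \<in> assignments n \<Sigma> \<Longrightarrow> \<delta> s a \<in> S"
    and r: "\<And>s a. s \<in> S \<Longrightarrow> a \<in> assignments n \<Sigma> \<Longrightarrow> r s a > 0"
    and g: "\<And>s. s \<in> S \<Longrightarrow> g s \<in> Out"
  shows "decoder_computes 1 n \<Sigma> Out (\<lambda>w. g ((machine_step n r \<delta> w ^^ t) s0)) t"
proof -
  let ?A = "assignments n \<Sigma>"
  \<comment> \<open>Coordinates: \<open>(Some a, None)\<close> for assignments, \<open>(None, Some s)\<close> for states, and
    \<open>(Some a, Some s)\<close> for the hidden units.\<close>
  define C where "C = (insert None (Some ` ?A)) \<times> (insert None (Some ` S))"
  define d where "d = card C"
  have "finite C" using assms(2,3) by (simp add: C_def)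
  then obtain c where c: "bij_betw c {0..<d} C"
    using ex_bij_betw_nat_finite d_def by blast
  define e where "e = inv_into {0..<d} c"
  have e: "e x < d" "c (e x) = x" if "x \<in> C" for x
    using that c inv_into_into[of x c "{0..<d}"] f_inv_into_f[of x c "{0..<d}"]
    by (auto simp: e_def bij_betw_def)
  have c_eq: "c i = x \<longleftrightarrow> i = e x" if "i < d" "x \<in> C" for i x
    using that e[OF that(2)] inj_onD[OF bij_betw_imp_inj_on[OF c], of i "e x"] by auto
  define x :: "nat \<times> 'a \<Rightarrow> real vec" where "x a = unit_vec d (e (Some a, None))" for a
  define y :: "'s \<Rightarrow> real vec" where "y s = unit_vec d (e (None, Some s))" for s
  \<comment> \<open>Summed over an assignment column and a state column, row \<open>(Some a, Some s)\<close> of \<open>f1\<close> is the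
    number of matches minus one; the state column supplies the bias.\<close>
  define f1 :: "(nat \<times> 'a) option \<times> 's option \<Rightarrow> (nat \<times> 'a) option \<times> 's option \<Rightarrow> real"
    where "f1 u v = (if fst u = None \<or> snd u = None then 0
      else of_bool (fst u = fst v) + of_bool (snd u = snd v) - of_bool (fst v = None))" for u v
  \<comment> \<open>Sends the hidden unit for a pair of assignment and state to the code of the next
    state.\<close>
  define f2 :: "(nat \<times> 'a) option \<times> 's option \<Rightarrow> (nat \<times> 'a) option \<times> 's option \<Rightarrow> real"
    where "f2 u v = of_bool (u = (None, Some (\<delta> (the (snd v)) (the (fst v)))))" for u v
  \<comment> \<open>The column of a state holds its scores in the rows naming an assignment; the
    zero rows make every state code score zero.\<close>
  define fq :: "(nat \<times> 'a) option \<times> 's option \<Rightarrow> (nat \<times> 'a) option \<times> 's option \<Rightarrow> real"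
    where "fq u v = (if fst u = None then 0 else r (the (snd v)) (the (fst u)))" for u v
  define M where "M f = mat d d (\<lambda>(i, j). f (c i) (c j))"
    for f :: "(nat \<times> 'a) option \<times> 's option \<Rightarrow> (nat \<times> 'a) option \<times> 's option \<Rightarrow> real"
  have M: "M f \<in> carrier_mat d d" for f by (simp add: M_def)
  have M_unit: "M f *\<^sub>v unit_vec d (e u) = vec d (\<lambda>i. f (c i) u)" if "u \<in> C" for f u
    using e[OF that] by (simp add: M_def mult_mat_unit_vec)
  define L where "L = \<lparr>heads = [(M fq, 1\<^sub>m d)], W1 = M f1, W2 = M f2, WO = 1\<^sub>m d\<rparr>"
  define p where "p tok = (case tok of Sym \<sigma> i \<Rightarrow> x (i, \<sigma>) | EoL \<Rightarrow> y s0)" for tok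
  obtain out0 where "out0 \<in> Out" using g assms(4) by blast
  \<comment> \<open>Decodes the one-hot states; \<open>out0\<close> makes \<open>\<alpha>\<close>
    map all remaining vectors into \<open>Out\<close> too.\<close>
  define \<alpha> where "\<alpha> u = (if u \<in> y ` S then g (inv_into S y u) else out0)" for u
  have inC: "(None, Some s) \<in> C" "(Some a, None) \<in> C" "(Some a, Some s) \<in> C"
    if "s \<in> S" "a \<in> ?A" for s a
    using that by (auto simp: C_def)
  have yC: "(None, Some s) \<in> C" if "s \<in> S" for s
    using that by (auto simp: C_def)
  have xy: "x a \<in> carrier_vec d" "y s \<in> carrier_vec d" for a s
    by (simp_all add: x_def y_def)
  have "inj_on y S"
  proof (rule inj_onI)
    fix s s' assume s: "s \<in> S" "s' \<in> S" "y s = y s'"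
    then have "e (None, Some s) = e (None, Some s')"
      using e(1)[OF yC] by (simp add: y_def)
    then show "s = s'"
      using e(2)[OF yC] s by (metis option.inject prod.inject)
  qed
  then have \<alpha>_y: "\<alpha> (y s) = g s" if "s \<in> S" for s
    using that by (simp add: \<alpha>_def)
  have score_x: "x a \<bullet> (M fq *\<^sub>v y s) = r s a" if "s \<in> S" "a \<in> ?A" for s a
    using inC[OF that] e by (simp add: x_def y_def M_unit fq_def)
  have score_y: "y s' \<bullet> (M fq *\<^sub>v y s) = 0" if "s \<in> S" "s' \<in> S" for s s'
    using yC that e by (simp add: y_def M_unit fq_def)
  \<comment> \<open>The sum is 1 on two matches and at most 0 otherwise, so ReLU leaves the
    indicator of the pair.\<close>
  have f1_pair: "max 0 (f1 u (Some a, None) + f1 u (None, Some s)) = of_bool (u = (Some a, Some s))"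
    for u a s
    by (cases "fst u = Some a"; cases "snd u = Some s") (auto simp: f1_def prod_eq_iff)
  have ffn: "M f2 *\<^sub>v relu (M f1 *\<^sub>v (x a + y s)) = y (\<delta> s a)" if "s \<in> S" "a \<in> ?A" for s a
  proof -
    note C = inC[OF that] yC[OF \<delta>[OF that]]
    have "M f1 *\<^sub>v (x a + y s) = vec d (\<lambda>i. f1 (c i) (Some a, None)) + vec d (\<lambda>i. f1 (c i) (None, Some s))"
      using C xy by (simp add: mult_add_distrib_mat_vec[OF M] x_def y_def M_unit)
    also have "relu \<dots> = unit_vec d (e (Some a, Some s))"
    proof (rule eq_vecI)
      fix i assume "i < dim_vec (unit_vec d (e (Some a, Some s)) :: real vec)"
      then have i: "i < d" by simp
      then show "relu (vec d (\<lambda>i. f1 (c i) (Some a, None)) + vec d (\<lambda>i. f1 (c i) (None, Some s))) $ i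
          = unit_vec d (e (Some a, Some s)) $ i"
        using e(1)[OF C(3)] c_eq[OF i C(3)] by (simp add: relu_def f1_pair)
    qed (simp add: relu_def)
    finally have "M f2 *\<^sub>v relu (M f1 *\<^sub>v (x a + y s)) = vec d (\<lambda>i. f2 (c i) (Some a, Some s))"
      using C by (simp add: M_unit)
    also have "\<dots> = y (\<delta> s a)"
      using e(1)[OF C(4)] c_eq[OF _ C(4)] by (intro eq_vecI) (auto simp: y_def f2_def)
    finally show ?thesis .
  qed
  \<comment> \<open>The invariant keeps all earlier \<open>y\<close> among the state codes, where
    attention scores vanish; the last one codes the current state.\<close>
  have run: "\<exists>ys. decoder_seq L p n w t = map x (consistent_assignments n w) @ ys \<and> ys \<noteq> [] \<and> set ys \<subseteq> y ` S
      \<and> (machine_step n r \<delta> w ^^ t) s0 \<in> S \<and> last ys = y ((machine_step n r \<delta> w ^^ t) s0)"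
    if w: "w \<in> inputs n \<Sigma>" for w t
  proof (induction t)
    case 0
    show ?case using assms(4)
      by (auto simp: consistent_assignments_def p_def comp_def simp del: upt_Suc)
  next
    case (Suc t)
    define s where "s = (machine_step n r \<delta> w ^^ t) s0"
    obtain ys where ys: "decoder_seq L p n w t = map x (consistent_assignments n w) @ ys" "ys \<noteq> []"
        "set ys \<subseteq> y ` S" "s \<in> S" "last ys = y s"
      using Suc.IH unfolding s_def by blast
    define sc where "sc v = (1\<^sub>m d *\<^sub>v v) \<bullet> (M fq *\<^sub>v y s)" for v
    note ne = consistent_assignments_nonempty[OF assms(1), of w]
    have sub: "a \<in> ?A" if "a \<in> set (consistent_assignments n w)" for a
      using that set_consistent_assignments[OF w] by auto
    define a where "a = leftmost_max (r s) (consistent_assignments n w)"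
    have a: "a \<in> ?A"
      using sub leftmost_max_in_set[OF ne] by (simp add: a_def)
    have "leftmost_max sc ys \<in> y ` S"
      using leftmost_max_in_set[OF ys(2)] ys(3) by blast
    then have "sc (leftmost_max sc ys) = 0"
      using score_y[OF ys(4)] xy by (auto simp: sc_def)
    moreover have "leftmost_max (\<lambda>a. sc (x a)) (consistent_assignments n w) = a"
      unfolding a_def using ne
      by (rule leftmost_max_cong) (use score_x[OF ys(4)] sub xy in \<open>auto simp: sc_def\<close>)
    moreover have "sc (x a) > 0"
      using r[OF ys(4) a] score_x[OF ys(4) a] xy by (simp add: sc_def)
    \<comment> \<open>The positive score of the winner beats the zero scores of the state
      codes.\<close>
    ultimately have "leftmost_max sc (map x (consistent_assignments n w) @ ys) = x a"
      using ne ys(2) by (simp add: leftmost_max_append leftmost_max_map)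
    then have "apply_layer L (map x (consistent_assignments n w) @ ys) = M f2 *\<^sub>v relu (M f1 *\<^sub>v (x a + y s))"
      using ys(2,5) xy
      by (subst apply_layer_one_head[of _ "M fq" "1\<^sub>m d"]) (auto simp: L_def sc_def[abs_def])
    then have "apply_layer L (map x (consistent_assignments n w) @ ys) = y (machine_step n r \<delta> w s)"
      using ffn[OF ys(4) a] by (simp add: machine_step_def a_def)
    moreover have "machine_step n r \<delta> w s \<in> S"
      using \<delta>[OF ys(4) a] by (simp add: machine_step_def a_def)
    ultimately show ?case
      using ys by (intro exI[of _ "ys @ [y (machine_step n r \<delta> w s)]"]) (auto simp: s_def[symmetric])
  qed
  show ?thesis
    unfolding decoder_computes_def
  proof (intro exI conjI ballI)
    show "is_layer d 1 L"
      using M by (simp add: is_layer_def L_def)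
    show "p \<in> tokens n \<Sigma> \<rightarrow> carrier_vec d"
      using xy by (auto simp: p_def split: token.split)
    show "\<alpha> \<in> carrier_vec d \<rightarrow> Out"
      using g \<open>out0 \<in> Out\<close> by (auto simp: \<alpha>_def inv_into_into)
    fix w assume "w \<in> inputs n \<Sigma>"
    from run[OF this, of t] show "g ((machine_step n r \<delta> w ^^ t) s0) = \<alpha> (last (decoder_seq L p n w t))"
      using \<alpha>_y by auto
  qed
qed

section \<open>Equality of rank and decoder depth\<close>

lemma decoder_computes_cong:
  assumes "\<And>w. w \<in> inputs n \<Sigma> \<Longrightarrow> f w = f' w"
  shows "decoder_computes H n \<Sigma> Out f t \<longleftrightarrow> decoder_computes H n \<Sigma> Out f' t"
  using assms by (simp add: decoder_computes_def cong: ball_cong)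

text \<open>Places the argument of \<open>\<alpha>\<close> in the domain on which its values are
  known to lie in \<open>Out\<close>; the dimension comes from the rows of
  \<open>W2\<close>.\<close>

lemma last_decoder_seq_carrier:
  assumes "is_layer d H L" "p EoL \<in> carrier_vec d"
  shows "last (decoder_seq L p n w t) \<in> carrier_vec d"
proof (cases t)
  case 0
  then show ?thesis using assms(2) by simp
next
  case (Suc s)
  have "W2 L \<in> carrier_mat d d" using assms(1) unfolding is_layer_def by blast
  then have "dim_row (W2 L) = d" by blast
  then have "apply_layer L xs \<in> carrier_vec d" for xs
    unfolding apply_layer_def by (intro carrier_vecI) simp
  then show ?thesis using Suc by simp
qed

theorem theorem1:
  fixes n :: nat and \<Sigma> :: "nat \<Rightarrow> 'a set" and Out :: "'o set" and f :: "(nat \<Rightarrow> 'a) \<Rightarrow> 'o"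
  assumes "n \<ge> 1"
    and "\<And>i. i \<in> {1..n} \<Longrightarrow> finite (\<Sigma> i) \<and> \<Sigma> i \<noteq> {}"
    and "finite Out" and "Out \<noteq> {}"
    and "f \<in> inputs n \<Sigma> \<rightarrow> Out"
  shows "rk n \<Sigma> Out f = dd 1 n \<Sigma> Out f"
proof -
  let ?computes = "\<lambda>T. dtree_over (inputs n \<Sigma>) (a_queries n \<Sigma>) Out T
      \<and> (\<forall>w\<in>inputs n \<Sigma>. dtree_eval T w = f w)"
  have finA: "finite (assignments n \<Sigma>)"
    using assms(2) by (intro finite_assignments) auto
  have finX: "finite (inputs n \<Sigma>)"
    unfolding inputs_def using assms(2) by (intro finite_PiE) auto
  have X: "inputs n \<Sigma> \<noteq> {}"
    unfolding inputs_def using assms(2) by (simp add: PiE_eq_empty_iff)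
  have "decoder_computes 1 n \<Sigma> Out f (dtree_depth T)" if T: "?computes T" for T
  proof -
    obtain S r \<delta> where M: "finite S" "T \<in> S"
        "\<And>T' a. T' \<in> S \<Longrightarrow> \<delta> T' a \<in> S"
        "\<And>T' a. T' \<in> S \<Longrightarrow> a \<in> assignments n \<Sigma> \<Longrightarrow> r T' a > 0"
        "\<And>w. w \<in> inputs n \<Sigma> \<Longrightarrow> (machine_step n r \<delta> w ^^ dtree_depth T) T = Leaf (dtree_eval T w)"
        "\<And>out. Leaf out \<in> S \<Longrightarrow> out \<in> Out"
      by (rule machine_of_dtree[OF assms(1) finX conjunct1[OF T]]) (rule that; assumption)
    obtain out0 where "out0 \<in> Out" using assms(4) by blast
    \<comment> \<open>The final state is a leaf; \<open>out0\<close> extends \<open>g\<close> to the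
      inner nodes with values in \<open>Out\<close>.\<close>
    define g where "g T' = (case T' of Leaf out \<Rightarrow> out | Node q ch \<Rightarrow> out0)"
      for T' :: "(nat \<Rightarrow> 'a, nat \<times> 'a, 'o) dtree"
    have "decoder_computes 1 n \<Sigma> Out
        (\<lambda>w. g ((machine_step n r \<delta> w ^^ dtree_depth T) T)) (dtree_depth T)"
      using assms(1) finA M(1,2,3,4)
      by (rule decoder_of_machine) (use M(6) \<open>out0 \<in> Out\<close> in \<open>auto simp: g_def split: dtree.split\<close>)
    then show ?thesis
      using M(5) T by (subst decoder_computes_cong) (auto simp: g_def)
  qed
  moreover have "\<exists>T. ?computes T \<and> dtree_depth T = t" if f: "decoder_computes 1 n \<Sigma> Out f t" for t
  proof -
    obtain d L p \<alpha> where L: "is_layer d 1 L" "p \<in> tokens n \<Sigma> \<rightarrow> carrier_vec d"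
        "\<alpha> \<in> carrier_vec d \<rightarrow> Out"
        "\<And>w. w \<in> inputs n \<Sigma> \<Longrightarrow> f w = \<alpha> (last (decoder_seq L p n w t))"
      using f unfolding decoder_computes_def by blast
    have "p EoL \<in> carrier_vec d" using L(2) by (auto simp: tokens_def)
    note carrier = last_decoder_seq_carrier[of d 1 L p, OF L(1) this]
    obtain Q K where "heads L = [(Q, K)]"
      using L(1) by (auto simp: is_layer_def length_Suc_conv)
    from machine_of_decoder[OF assms(1) this]
    obtain r \<delta> where run: "\<And>w t. last (decoder_seq L p n w t) =
        last ((machine_step n r \<delta> w ^^ t) [p EoL])"
      by metis
    obtain out0 where "out0 \<in> Out" using assms(4) by blast
    \<comment> \<open>The tree construction needs an output in \<open>Out\<close> for every state,
      whereas \<open>\<alpha>\<close> guarantees one only on \<open>carrier_vec d\<close>.\<close>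
    define g where "g ys = (if last ys \<in> carrier_vec d then \<alpha> (last ys) else out0)" for ys
    have "g ys \<in> Out" for ys
      using L(3) \<open>out0 \<in> Out\<close> by (auto simp: g_def)
    from dtree_of_machine[where g = g and t = t and r = r and \<delta> = \<delta> and s = "[p EoL]",
        OF assms(1) finA X this]
    show ?thesis
      using L(4) carrier[of n, unfolded run] by (auto simp: g_def run)
  qed
  \<comment> \<open>Both translations preserve the depth exactly, so the sets of attainable depths
    coincide, and with them their infima.\<close>
  ultimately have "{enat (dtree_depth T) | T. ?computes T}
      = {enat t | t. decoder_computes 1 n \<Sigma> Out f t}"
    by blast
  then show ?thesis by (simp add: rk_def dd_def)
qed

end
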